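(* Let $X$ be a non-negative and absolutely continuous random variable and let $Y=aX+b$, where $a>0$ and $b\ge 0$. Then, for all $t_1<t_2$ in the support $S_Y$ of $Y$ with $F_Y(t_1)<F_Y(t_2)$, $$IJ_Y(t_1,t_2)=\frac1a\, IJ_X\!\left(\frac{t_1-b}{a},\frac{t_2-b}{a}\right).$$
   Context: For a non-negative absolutely continuous random variable $Z$ with pdf $f_Z$ and cdf $F_Z$, and $0\le t_1<t_2$ with $F_Z(t_1)<F_Z(t_2)$, the interval extropy of $Z$ is $$IJ_Z(t_1,t_2)=-\frac{1}{2(F_Z(t_2)-F_Z(t_1))^2}\int_{t_1}^{t_2} f_Z^2(x)\,dx,$$ with values in $[-\infty,0]$. *)

theory Defs
  imports "HOL-Probability.Probability"
begin

definition abs_cont_rv :: "'w measure \<Rightarrow> ('w \<Rightarrow> real) \<Rightarrow> bool" where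
  "abs_cont_rv M Z \<longleftrightarrow> Z \<in> borel_measurable M \<and> absolutely_continuous lborel (distr M borel Z)"

definition rv_cdf :: "'w measure \<Rightarrow> ('w \<Rightarrow> real) \<Rightarrow> real \<Rightarrow> real" where
  "rv_cdf M Z = cdf (distr M borel Z)"

definition rv_pdf :: "'w measure \<Rightarrow> ('w \<Rightarrow> real) \<Rightarrow> real \<Rightarrow> ennreal" where
  "rv_pdf M Z = RN_deriv lborel (distr M borel Z)"

text \<open>The topological support of the law: every neighbourhood of the point has positive
  probability.\<close>

definition rv_support :: "'w measure \<Rightarrow> ('w \<Rightarrow> real) \<Rightarrow> real set" where
  "rv_support M Z = {x. \<forall>U. open U \<and> x \<in> U \<longrightarrow> 0 < measure (distr M borel Z) U}"

text \<open>The integral may be infinite, hence the values in the extended reals. The definition is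
  meaningful for absolutely continuous \<open>Z\<close> when the two values of the cdf differ;
  the choice of the version of the density is irrelevant by
  \<open>interval_extropy_distributed\<close> below.\<close>

definition interval_extropy :: "'w measure \<Rightarrow> ('w \<Rightarrow> real) \<Rightarrow> real \<Rightarrow> real \<Rightarrow> ereal" where
  "interval_extropy M Z t1 t2 =
     - (ereal (1 / (2 * (rv_cdf M Z t2 - rv_cdf M Z t1)\<^sup>2))
        * enn2ereal (\<integral>\<^sup>+x\<in>{t1..t2}. (rv_pdf M Z x)\<^sup>2 \<partial>lborel))"

lemma abs_cont_rv_distributed:
  assumes "prob_space M" "abs_cont_rv M Z"
  shows "distributed M lborel Z (rv_pdf M Z)"
proof -
  have eq: "distr M lborel Z = distr M borel Z"
    by (rule distr_cong) auto
  show ?thesis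
    using assms(2) unfolding distributed_def abs_cont_rv_def rv_pdf_def eq
    by (auto simp: sigma_finite_measure.density_RN_deriv[OF sigma_finite_lborel])
qed

lemma interval_extropy_distributed:
  assumes "distributed M lborel Z f"
  shows "interval_extropy M Z t1 t2 =
     - (ereal (1 / (2 * (rv_cdf M Z t2 - rv_cdf M Z t1)\<^sup>2))
        * enn2ereal (\<integral>\<^sup>+x\<in>{t1..t2}. (f x)\<^sup>2 \<partial>lborel))"
proof -
  have eq: "distr M lborel Z = distr M borel Z"
    by (rule distr_cong) auto
  have "AE x in lborel. f x = rv_pdf M Z x"
    unfolding rv_pdf_def using assms eq
    by (intro sigma_finite_measure.RN_deriv_unique sigma_finite_lborel) (auto simp: distributed_def)
  then have "(\<integral>\<^sup>+x\<in>{t1..t2}. (rv_pdf M Z x)\<^sup>2 \<partial>lborel) = (\<integral>\<^sup>+x\<in>{t1..t2}. (f x)\<^sup>2 \<partial>lborel)"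
    by (intro nn_integral_cong_AE) auto
  then show ?thesis
    by (simp add: interval_extropy_def)
qed

end

theory Submission
  imports Defs
begin

text \<open>If \<open>X\<close> has density \<open>f\<close>, then \<open>a * X + b\<close> has
  density \<open>f ((y - b) / a) / a\<close>. Substituting \<open>y = b + a * x\<close> in the
  integral of its square gives a Jacobian \<open>a\<close> against a factor
  \<open>1 / a\<^sup>2\<close>, so \<open>1 / a\<close> remains
  (\<open>ennreal_mult_power2_divide\<close>). The normalising factor does not change, since the cdf
  values at corresponding endpoints agree (\<open>rv_cdf_affine\<close>).\<close>

lemma ennreal_mult_power2_divide:
  fixes g :: ennreal
  assumes "(a::real) > 0"
  shows "ennreal a * (g / ennreal a)\<^sup>2 = ennreal (1 / a) * g\<^sup>2"
proof -
  have inv: "g / ennreal a = ennreal (1 / a) * g"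
    using assms by (simp add: divide_ennreal_def inverse_ennreal inverse_eq_divide mult.commute)
  have "ennreal a * (ennreal (1 / a) * ennreal (1 / a)) = ennreal (1 / a)"
    using assms by (simp flip: ennreal_mult)
  then show ?thesis
    unfolding inv by (simp add: power2_eq_square ac_simps)
qed

text \<open>For \<open>a > 0\<close> the affine map is increasing, so the two events being measured
  are the same set.\<close>

lemma rv_cdf_affine:
  assumes "X \<in> borel_measurable M" "a > 0"
  shows "rv_cdf M (\<lambda>\<omega>. a * X \<omega> + b) t = rv_cdf M X ((t - b) / a)"
proof -
  have "(\<lambda>\<omega>. a * X \<omega> + b) -` {..t} = X -` {..(t - b) / a}"
    using assms(2) by (auto simp: field_simps)
  then show ?thesis
    using assms(1) by (simp add: rv_cdf_def cdf_def measure_distr)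
qed

text \<open>Any density \<open>f\<close> of \<open>X\<close> may be used:
  \<open>interval_extropy_distributed\<close> replaces the Radon-Nikodym derivatives by
  \<open>f\<close> and by the explicit transformed density \<open>g\<close>.\<close>

lemma (in prob_space) interval_extropy_affine:
  assumes X: "distributed M lborel X f" and a: "a > 0"
  shows "interval_extropy M (\<lambda>\<omega>. a * X \<omega> + b) t1 t2
           = ereal (1 / a) * interval_extropy M X ((t1 - b) / a) ((t2 - b) / a)"
proof -
  have f[measurable]: "f \<in> borel_measurable borel"
    using distributed_borel_measurable[OF X] by simp
  define g where "g y = f ((y - b) / a) / ennreal a" for y
  have Y: "distributed M lborel (\<lambda>\<omega>. a * X \<omega> + b) g"
    using distributed_affine[OF X, of a b] a by (simp add: g_def[abs_def] add.commute)
  have "(\<integral>\<^sup>+y\<in>{t1..t2}. (g y)\<^sup>2 \<partial>lborel)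
      = ennreal a * (\<integral>\<^sup>+x. (g (b + a * x))\<^sup>2 * indicator {t1..t2} (b + a * x) \<partial>lborel)"
    unfolding g_def using a by (subst nn_integral_real_affine[where c=a and t=b]) auto
  \<comment> \<open>The factor \<open>a\<close> moves under the integral to meet the squared density
    pointwise; as \<open>a > 0\<close>, the indicator pulls back to the rescaled interval.\<close>
  also have "\<dots> = (\<integral>\<^sup>+x. ennreal (1 / a)
      * ((f x)\<^sup>2 * indicator {(t1 - b) / a..(t2 - b) / a} x) \<partial>lborel)"
    unfolding g_def using a
    by (subst nn_integral_cmult[symmetric])
       (auto intro!: nn_integral_cong split: split_indicator
         simp: ennreal_mult_power2_divide field_simps)
  also have "\<dots> = ennreal (1 / a)
      * (\<integral>\<^sup>+x\<in>{(t1 - b) / a..(t2 - b) / a}. (f x)\<^sup>2 \<partial>lborel)"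
    by (rule nn_integral_cmult) auto
  finally have int: "(\<integral>\<^sup>+y\<in>{t1..t2}. (g y)\<^sup>2 \<partial>lborel) = \<dots>" .
  have "X \<in> borel_measurable M"
    using distributed_measurable[OF X] by simp
  then show ?thesis
    unfolding interval_extropy_distributed[OF X] interval_extropy_distributed[OF Y] int
    \<comment> \<open>\<open>enn2ereal\<close> is multiplicative, so \<open>1 / a\<close> can be
      pulled out even when the integral is infinite.\<close>
    using a by (simp add: rv_cdf_affine times_ennreal.rep_eq enn2ereal_ennreal mult_ac)
qed

theorem proposition3:
  fixes M :: "'w measure" and X Y :: "'w \<Rightarrow> real" and a b :: real
  assumes "prob_space M"
    and "abs_cont_rv M X"
    and "AE \<omega> in M. 0 \<le> X \<omega>"
    and "a > 0" and "b \<ge> 0"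
    and "Y = (\<lambda>\<omega>. a * X \<omega> + b)"
  shows "\<forall>t1\<in>rv_support M Y. \<forall>t2\<in>rv_support M Y.
           t1 < t2 \<and> rv_cdf M Y t1 < rv_cdf M Y t2 \<longrightarrow>
           interval_extropy M Y t1 t2
             = ereal (1 / a) * interval_extropy M X ((t1 - b) / a) ((t2 - b) / a)"
  using prob_space.interval_extropy_affine[OF assms(1) abs_cont_rv_distributed[OF assms(1,2)] assms(4)]
  unfolding assms(6) by blast

end
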